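(* Let $X$ be a real Hilbert space whose dual space $X^*$ is identified with $X$. Let $M:X\to X$ be a bounded linear operator with closed range, let $q\in X$, and let $C\subset X$ be a nonempty polyhedral convex set, that is, $C=\{x\in X : \langle x_i^*,x\rangle\le \alpha_i,\ i=1,\dots,m\}$ for some $x_i^*\in X$ and $\alpha_i\in\mathbb{R}$, $i=1,\dots,m$. Define the residual mapping $R:X\to X$ by $$R(x)=x-P_C(x-Mx-q)\quad\text{for every } x\in X,$$ where $P_C(u)$ denotes the metric projection of $u\in X$ on $C$. Then there exists a constant $c>0$ such that the multifunction $R^{-1}:X\rightrightarrows X$, $R^{-1}(y)=\{x\in X: R(x)=y\}$, is locally upper Lipschitzian at every point of $X$ with modulus $c$.
   Context: A multifunction $F$ from a normed space $X$ to a normed space $Y$ (values may be empty) is called locally upper Lipschitzian at $x_0\in X$ with modulus $c>0$ if there exists $\varepsilon>0$ such that $F(x)\subset F(x_0)+c\|x-x_0\|\bar B_Y$ for every $x\in B(x_0,\varepsilon)$. Here $B(x_0,\varepsilon)$ is the open ball with center $x_0$ and radius $\varepsilon$, $\bar B_Y$ is the closed unit ball of $Y$, and $\emptyset+A=\emptyset$ for every set $A$. In the claim the constant $c$ is the same for all points of $X$, while the radius $\varepsilon$ may depend on the point. The metric projection $P_C(u)$ of $u$ on a nonempty closed convex set $C$ in a Hilbert space is the unique point of $C$ nearest to $u$. *)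

theory Defs
  imports "HOL-Analysis.Analysis" "HOL-Library.Set_Algebras"
begin

text \<open>
  The library function \<open>closest_point\<close> is restricted to Heine-Borel spaces, which excludes
  infinite-dimensional Hilbert spaces. The description below denotes the nearest point whenever
  it exists and is unique, in particular if \<open>C\<close> is nonempty, closed and convex in a Hilbert space.
\<close>

definition metric_projection :: "'a::real_inner set \<Rightarrow> 'a \<Rightarrow> 'a" where
  "metric_projection C u = (THE p. p \<in> C \<and> (\<forall>z\<in>C. dist u p \<le> dist u z))"

definition residual :: "('a::real_inner \<Rightarrow> 'a) \<Rightarrow> 'a \<Rightarrow> 'a set \<Rightarrow> 'a \<Rightarrow> 'a" where
  "residual M q C x = x - metric_projection C (x - M x - q)"

text \<open>
  A multifunction is a set-valued function; its values may be empty. The outer addition is the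
  Minkowski sum of \<open>HOL-Library.Set_Algebras\<close>, so a sum with an empty summand is empty. Hence
  if \<open>F x0 = {}\<close>, the condition says that \<open>F\<close> has empty values on a neighbourhood of \<open>x0\<close>.
\<close>

definition locally_upper_lipschitzian_at ::
    "('a::real_normed_vector \<Rightarrow> 'b::real_normed_vector set) \<Rightarrow> 'a \<Rightarrow> real \<Rightarrow> bool" where
  "locally_upper_lipschitzian_at F x0 c \<longleftrightarrow>
     c > 0 \<and>
     (\<exists>\<epsilon>>0. \<forall>x\<in>ball x0 \<epsilon>.
        F x \<subseteq> F x0 + (\<lambda>b. (c * norm (x - x0)) *\<^sub>R b) ` cball 0 1)"

end

theory Submission
  imports Defs
begin

text \<open>
  Between finite-dimensional spaces, a multifunction whose graph is a finite union of polyhedra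
  is locally upper Lipschitzian, with a modulus that does not depend on the point. The proof
  transfers this principle of Robinson to the inverse of the residual mapping on a Hilbert space
  \<open>X\<close>, where the finitely many inequalities are accompanied by one operator equation with closed
  range.

  By the variational characterization of the projection, \<open>R x = y\<close> says that \<open>x - y \<in> C\<close> and that
  \<open>y - M x - q\<close> lies in the normal cone of \<open>C\<close> at \<open>x - y\<close>. By Farkas' lemma
  (\<open>normal_cone_polyhedron\<close>) this normal cone is generated by the active ones among the
  constraint normals \<open>a\<^sub>i\<close>, and by Caratheodory's theorem for cones (\<open>conic_caratheodory\<close>)
  linearly independent ones suffice. Hence \<open>R\<^sup>-\<^sup>1 y\<close> is the union, over the index sets \<open>J\<close> of
  independent normals, of the sets \<open>F\<^sub>J y\<close> of all \<open>x\<close> with \<open>x - y \<in> C\<close>, \<open>a\<^sub>j \<bullet> (x - y) = \<alpha>\<^sub>j\<close> for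
  \<open>j \<in> J\<close>, and \<open>y - M x - q\<close> in the cone generated by the \<open>a\<^sub>j\<close> with \<open>j \<in> J\<close>
  (\<open>residual_inverse_eq_UN_pieces\<close>). Independence of the \<open>a\<^sub>j\<close> provides dual vectors \<open>d\<^sub>j\<close>. With
  the linear map \<open>Q v = v - (\<Sum>j\<in>J. (d\<^sub>j \<bullet> v) a\<^sub>j)\<close>, which annihilates the span of the \<open>a\<^sub>j\<close>, the
  last condition becomes the equation \<open>Q (M x) = Q (y - q)\<close> together with the inequalities \<open>d\<^sub>j \<bullet>
  M x \<le> d\<^sub>j \<bullet> (y - q)\<close>. The operator \<open>Q \<circ> M\<close> inherits the closed range of \<open>M\<close>, because adding a
  finite-dimensional subspace to a closed subspace keeps it closed
  (\<open>closed_range_dual_remainder\<close>).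

  So each \<open>F\<^sub>J\<close> is a system \<open>T x = t\<close>, \<open>f\<^sub>k x \<le> \<beta>\<^sub>k\<close> whose right-hand sides depend Lipschitz
  continuously on \<open>y\<close>. Hoffman's error bound for such systems
  (\<open>hoffman_error_bound_closed_range\<close>) makes \<open>F\<^sub>J\<close> Lipschitz on its domain: the equation is
  corrected through a bounded right inverse of \<open>T\<close>, a consequence of the Baire category theorem,
  and the inequalities are then corrected within the kernel of \<open>T\<close>, where projecting onto the
  feasible polyhedron moves the point by a nonnegative combination of independent normals with
  controlled coefficients. Finally, a closed graph and Lipschitz continuity on the domain force
  the domain to be closed, so near a point outside it the values are empty, and near a point
  inside it the Lipschitz estimate applies (\<open>locally_upper_lipschitzian_if_lipschitz_on_domain\<close>).
  The sum of the finitely many constants, enlarged by one to be positive, serves for the union.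
\<close>

section \<open>Projections in Hilbert space\<close>

text \<open>
  In infinite dimensions closed bounded sets need not be compact; completeness is used instead: a
  minimizing sequence converges.
\<close>

lemma nearest_point_exists:
  fixes S :: "'a::{real_inner,banach} set"
  assumes "closed S" "convex S" "S \<noteq> {}"
  shows "\<exists>p\<in>S. \<forall>z\<in>S. dist u p \<le> dist u z"
proof -
  define D where "D = (\<lambda>z. (dist u z)\<^sup>2) ` S"
  define d where "d = Inf D"
  have bdd: "bdd_below D"
    unfolding D_def by (intro bdd_belowI2[of _ 0]) simp
  have d_le: "d \<le> (dist u z)\<^sup>2" if "z \<in> S" for z
    unfolding d_def using that bdd by (intro cInf_lower) (auto simp: D_def)
  have "\<exists>z\<in>S. (dist u z)\<^sup>2 < d + inverse (real (Suc n))" for n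
  proof -
    have "Inf D < d + inverse (real (Suc n))" by (simp add: d_def)
    moreover have "D \<noteq> {}" using assms(3) by (simp add: D_def)
    ultimately obtain e where "e \<in> D" "e < d + inverse (real (Suc n))"
      using cInf_lessD by blast
    then show ?thesis by (auto simp: D_def)
  qed
  then obtain z where zS: "\<And>n. z n \<in> S"
    and zd: "\<And>n. (dist u (z n))\<^sup>2 < d + inverse (real (Suc n))" by metis
  \<comment> \<open>By the parallelogram law and since midpoints stay in \<open>S\<close>, a minimizing sequence is Cauchy.\<close>
  have close: "(dist (z n) (z k))\<^sup>2 \<le> 2 * inverse (real (Suc n)) + 2 * inverse (real (Suc k))" for n k
  proof -
    have "(1/2) *\<^sub>R z n + (1/2) *\<^sub>R z k \<in> S"
      using convexD[OF assms(2) zS zS, of "1/2" "1/2"] by simp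
    then have "d \<le> (dist u ((1/2) *\<^sub>R z n + (1/2) *\<^sub>R z k))\<^sup>2" by (rule d_le)
    moreover have "(dist (z n) (z k))\<^sup>2 = 2 * (dist u (z n))\<^sup>2 + 2 * (dist u (z k))\<^sup>2
        - 4 * (dist u ((1/2) *\<^sub>R z n + (1/2) *\<^sub>R z k))\<^sup>2"
      unfolding dist_norm power2_norm_eq_inner
      by (simp add: inner_diff inner_add inner_commute field_simps)
    ultimately show ?thesis using zd[of n] zd[of k] by linarith
  qed
  have "Cauchy z"
  proof (rule metric_CauchyI)
    fix e :: real assume "e > 0"
    obtain N where N: "inverse (real (Suc N)) < e\<^sup>2 / 4"
      using reals_Archimedean[of "e\<^sup>2/4"] \<open>e > 0\<close> by auto
    show "\<exists>N. \<forall>n\<ge>N. \<forall>k\<ge>N. dist (z n) (z k) < e"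
    proof (intro exI allI impI)
      fix n k assume "N \<le> n" "N \<le> k"
      then have "inverse (real (Suc n)) \<le> inverse (real (Suc N))"
        "inverse (real (Suc k)) \<le> inverse (real (Suc N))"
        by (auto intro!: le_imp_inverse_le)
      then have "(dist (z n) (z k))\<^sup>2 < e\<^sup>2" using close[of n k] N by linarith
      then show "dist (z n) (z k) < e" using \<open>e > 0\<close> by (intro power2_less_imp_less[of "dist (z n) (z k)" e]) auto
    qed
  qed
  then obtain p where p: "z \<longlonglongrightarrow> p" using Cauchy_convergent convergentD by blast
  have "p \<in> S" using closed_sequentially[OF assms(1)] zS p by blast
  moreover have "dist u p \<le> dist u y" if "y \<in> S" for y
  proof -
    have "(\<lambda>n. (dist u (z n))\<^sup>2) \<longlonglongrightarrow> (dist u p)\<^sup>2"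
      by (intro tendsto_intros p)
    moreover have "(\<lambda>n. d + inverse (real (Suc n))) \<longlonglongrightarrow> d + 0"
      by (intro tendsto_add tendsto_const LIMSEQ_inverse_real_of_nat)
    ultimately have "(dist u p)\<^sup>2 \<le> d + 0"
      by (rule LIMSEQ_le) (use zd less_imp_le in blast)
    also have "\<dots> \<le> (dist u y)\<^sup>2" using d_le[OF that] by simp
    finally show ?thesis by (rule power2_le_imp_le) simp
  qed
  ultimately show ?thesis by blast
qed

lemma nearest_point_iff_obtuse:
  fixes S :: "'a::real_inner set"
  assumes "closed S" "convex S" "p \<in> S"
  shows "(\<forall>z\<in>S. dist u p \<le> dist u z) \<longleftrightarrow> (\<forall>z\<in>S. (u - p) \<bullet> (z - p) \<le> 0)"
proof
  assume "\<forall>z\<in>S. dist u p \<le> dist u z"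
  then show "\<forall>z\<in>S. (u - p) \<bullet> (z - p) \<le> 0"
    using any_closest_point_dot[OF assms(2,1,3)] by blast
next
  assume obtuse: "\<forall>z\<in>S. (u - p) \<bullet> (z - p) \<le> 0"
  show "\<forall>z\<in>S. dist u p \<le> dist u z"
  proof
    fix z assume "z \<in> S"
    have "(dist u z)\<^sup>2 = (dist u p)\<^sup>2 + (dist z p)\<^sup>2 - 2 * ((u - p) \<bullet> (z - p))"
      unfolding dist_norm power2_norm_eq_inner
      by (simp add: inner_diff inner_commute)
    moreover have "0 \<le> (dist z p)\<^sup>2" by simp
    moreover have "(u - p) \<bullet> (z - p) \<le> 0" using obtuse \<open>z \<in> S\<close> by blast
    ultimately have "(dist u p)\<^sup>2 \<le> (dist u z)\<^sup>2" by linarith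
    then show "dist u p \<le> dist u z" by (rule power2_le_imp_le) simp
  qed
qed

lemma projection_exists:
  fixes S :: "'a::{real_inner,banach} set"
  assumes "closed S" "convex S" "S \<noteq> {}"
  obtains p where "p \<in> S" "\<And>z. z \<in> S \<Longrightarrow> (u - p) \<bullet> (z - p) \<le> 0"
  using nearest_point_exists[OF assms, of u] nearest_point_iff_obtuse[OF assms(1,2)] by metis

lemma metric_projection_eq_iff:
  fixes S :: "'a::{real_inner,banach} set"
  assumes "closed S" "convex S" "S \<noteq> {}"
  shows "metric_projection S u = p \<longleftrightarrow> p \<in> S \<and> (\<forall>z\<in>S. (u - p) \<bullet> (z - p) \<le> 0)"
proof -
  let ?near = "\<lambda>p. p \<in> S \<and> (\<forall>z\<in>S. dist u p \<le> dist u z)"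
  have uniq: "p' = p''" if "?near p'" "?near p''" for p' p''
    using any_closest_point_unique[OF assms(2,1)] that by blast
  obtain p0 where p0: "?near p0" using nearest_point_exists[OF assms] by blast
  have "metric_projection S u = p \<longleftrightarrow> ?near p"
    unfolding metric_projection_def using the_equality[of ?near, OF p0] uniq p0 by blast
  then show ?thesis using nearest_point_iff_obtuse[OF assms(1,2)] by blast
qed

text \<open>
  On a subspace both \<open>p + w\<close> and \<open>p - w\<close> are admissible comparison points, so the obtuse angle
  condition for the projection \<open>p\<close> becomes orthogonality.
\<close>

lemma orthogonal_decomposition:
  fixes W :: "'a::{real_inner,banach} set"
  assumes "closed W" "subspace W"
  obtains p where "p \<in> W" "\<And>w. w \<in> W \<Longrightarrow> (x - p) \<bullet> w = 0"
proof -
  obtain p where pW: "p \<in> W" and p: "\<And>z. z \<in> W \<Longrightarrow> (x - p) \<bullet> (z - p) \<le> 0"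
    using projection_exists[OF assms(1) subspace_imp_convex[OF assms(2)], of x]
      subspace_0[OF assms(2)] by blast
  have le: "(x - p) \<bullet> w \<le> 0" if "w \<in> W" for w
    using p[of "p + w"] subspace_add[OF assms(2) pW that] by simp
  have "(x - p) \<bullet> w = 0" if "w \<in> W" for w
    using le[OF that] le[OF subspace_neg[OF assms(2) that]] by simp
  with pW show thesis by (rule that)
qed

text \<open>
  After replacing \<open>b\<close> by its component \<open>r\<close> orthogonal to \<open>W\<close>, membership in the sum can be tested by
  removing the component along \<open>r\<close>, which is a continuous operation. If \<open>b \<in> W\<close>, then \<open>r = 0\<close>
  and the quotient below is \<open>0\<close> by the convention for division by zero, as it should be.
\<close>

lemma closed_subspace_plus_line:
  fixes W :: "'a::{real_inner,banach} set"
  assumes "closed W" "subspace W"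
  shows "closed {w + t *\<^sub>R b | w t. w \<in> W}"
proof -
  obtain p where p: "p \<in> W" and orth: "\<And>w. w \<in> W \<Longrightarrow> (b - p) \<bullet> w = 0"
    using orthogonal_decomposition[OF assms] by blast
  define r where "r = b - p"
  have "{w + t *\<^sub>R b | w t. w \<in> W} = {z. z - ((r \<bullet> z) / (r \<bullet> r)) *\<^sub>R r \<in> W}"
  proof (intro set_eqI iffI)
    fix z assume "z \<in> {w + t *\<^sub>R b | w t. w \<in> W}"
    then obtain w t where w: "w \<in> W" and z: "z = w + t *\<^sub>R b" by blast
    have wp: "w + t *\<^sub>R p \<in> W"
      using w p assms(2) by (simp add: subspace_add subspace_scale)
    have z': "z = (w + t *\<^sub>R p) + t *\<^sub>R r" by (simp add: z r_def algebra_simps)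
    have "r \<bullet> z = t * (r \<bullet> r)"
      using orth[OF wp] unfolding z' by (simp add: inner_add_right flip: r_def)
    then have eq: "((r \<bullet> z) / (r \<bullet> r)) *\<^sub>R r = t *\<^sub>R r" by (cases "r = 0") auto
    have "z - ((r \<bullet> z) / (r \<bullet> r)) *\<^sub>R r = w + t *\<^sub>R p" unfolding eq by (simp add: z')
    then show "z \<in> {z. z - ((r \<bullet> z) / (r \<bullet> r)) *\<^sub>R r \<in> W}" using wp by simp
  next
    fix z assume "z \<in> {z. z - ((r \<bullet> z) / (r \<bullet> r)) *\<^sub>R r \<in> W}"
    moreover define t where "t = (r \<bullet> z) / (r \<bullet> r)"
    ultimately have "z - t *\<^sub>R r \<in> W" by simp
    then have "(z - t *\<^sub>R r) - t *\<^sub>R p \<in> W"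
      using p assms(2) by (simp add: subspace_diff subspace_scale)
    moreover have "z = ((z - t *\<^sub>R r) - t *\<^sub>R p) + t *\<^sub>R b" by (simp add: r_def algebra_simps)
    ultimately show "z \<in> {w + t *\<^sub>R b | w t. w \<in> W}" by blast
  qed
  also have "\<dots> = (\<lambda>z. z - ((r \<bullet> z) / (r \<bullet> r)) *\<^sub>R r) -` W" by auto
  also have "closed \<dots>"
    by (intro continuous_closed_vimage assms(1)) (auto intro!: continuous_intros simp: divide_inverse)
  finally show ?thesis .
qed

lemma closed_subspace_plus_finite_span:
  fixes W :: "'a::{real_inner,banach} set"
  assumes "closed W" "subspace W" "finite B"
  shows "closed {w + s | w s. w \<in> W \<and> s \<in> span B}"
  using assms(3)
proof induction
  case empty
  show ?case using assms(1) by simp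
next
  case (insert b B)
  let ?V = "{w + s | w s. w \<in> W \<and> s \<in> span B}"
  have "{w + s | w s. w \<in> W \<and> s \<in> span (insert b B)} = {v + t *\<^sub>R b | v t. v \<in> ?V}" (is "?L = ?R")
  proof (intro set_eqI iffI)
    fix z assume "z \<in> ?L"
    then obtain w s where w: "w \<in> W" and s: "s \<in> span (insert b B)" and z: "z = w + s" by blast
    from s obtain t where "s - t *\<^sub>R b \<in> span B" using span_breakdown_eq by blast
    moreover have "z = (w + (s - t *\<^sub>R b)) + t *\<^sub>R b" using z by simp
    ultimately show "z \<in> ?R" using w by blast
  next
    fix z assume "z \<in> ?R"
    then obtain w s t where "w \<in> W" "s \<in> span B" and z: "z = (w + s) + t *\<^sub>R b" by blast
    moreover from this have "s + t *\<^sub>R b \<in> span (insert b B)"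
      using span_breakdown_eq[of "s + t *\<^sub>R b" b B] by (auto intro!: exI[of _ t])
    moreover have "z = w + (s + t *\<^sub>R b)" using z by (simp add: algebra_simps)
    ultimately show "z \<in> ?L" by blast
  qed
  moreover have "subspace ?V" using subspace_sums[OF assms(2) subspace_span] .
  ultimately show ?case using closed_subspace_plus_line[OF insert.IH] by simp
qed

lemma closed_finite_span:
  fixes B :: "'a::{real_inner,banach} set"
  assumes "finite B"
  shows "closed (span B)"
  using closed_subspace_plus_finite_span[of "{0::'a}", OF _ _ assms] by (simp add: subspace_0 subspace_single_0)

text \<open>
  The representing vector is taken in \<open>N\<close> itself, so that combinations of such vectors stay in \<open>N\<close>;
  the error bound within the kernel of an operator relies on this.
\<close>

lemma riesz_representation_on_subspace:
  fixes N :: "'a::{real_inner,banach} set"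
  assumes "closed N" "subspace N" "bounded_linear f"
  shows "\<exists>a\<in>N. \<forall>x\<in>N. f x = a \<bullet> x"
proof (cases "\<forall>x\<in>N. f x = 0")
  case True
  then show ?thesis using subspace_0[OF assms(2)] by (intro bexI[of _ 0]) auto
next
  case False
  interpret f: bounded_linear f by fact
  from False obtain e where e: "e \<in> N" "f e \<noteq> 0" by blast
  define K where "K = N \<inter> {x. f x = 0}"
  have "closed K" unfolding K_def
    by (intro closed_Int assms(1) closed_Collect_eq continuous_intros f.continuous_on)
  moreover have "subspace K"
    using assms(2) by (auto simp: K_def subspace_def f.add f.scaleR f.zero)
  ultimately obtain p where p: "p \<in> K" and orth: "\<And>w. w \<in> K \<Longrightarrow> (e - p) \<bullet> w = 0"
    using orthogonal_decomposition by blast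
  \<comment> \<open>On \<open>N\<close>, \<open>r\<close> spans the orthogonal complement of the kernel of \<open>f\<close>.\<close>
  define r where "r = e - p"
  have rN: "r \<in> N" using e p subspace_diff[OF assms(2)] by (simp add: r_def K_def)
  have fr: "f r \<noteq> 0" using e p by (simp add: r_def K_def f.diff)
  then have r0: "r \<bullet> r \<noteq> 0" using f.zero by auto
  show ?thesis
  proof (intro bexI ballI)
    show "(f r / (r \<bullet> r)) *\<^sub>R r \<in> N" using rN assms(2) by (simp add: subspace_scale)
    fix x assume "x \<in> N"
    then have "x - (f x / f r) *\<^sub>R r \<in> K"
      using fr rN assms(2) by (auto simp: K_def f.diff f.scaleR subspace_diff subspace_scale)
    then have "r \<bullet> (x - (f x / f r) *\<^sub>R r) = 0" using orth by (simp flip: r_def)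
    then have "r \<bullet> x = (f x / f r) * (r \<bullet> r)" by (simp add: inner_diff_right)
    then show "f x = ((f r / (r \<bullet> r)) *\<^sub>R r) \<bullet> x" using fr r0 by simp
  qed
qed

section \<open>Finitely generated cones and the Hoffman error bound\<close>

text \<open>
  Linear independence of an indexed family. In contrast to independence of the image set, it
  excludes repetitions.
\<close>

definition independent_family :: "('i \<Rightarrow> 'a::real_vector) \<Rightarrow> 'i set \<Rightarrow> bool" where
  "independent_family a J \<longleftrightarrow> (\<forall>j\<in>J. a j \<notin> span (a ` (J - {j})))"

definition generated_cone :: "('i \<Rightarrow> 'a::real_vector) \<Rightarrow> 'i set \<Rightarrow> 'a set" where
  "generated_cone a J = {v. \<exists>l. (\<forall>j\<in>J. 0 \<le> l j) \<and> v = (\<Sum>j\<in>J. l j *\<^sub>R a j)}"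

lemma generated_coneI:
  "(\<And>j. j \<in> J \<Longrightarrow> 0 \<le> l j) \<Longrightarrow> v = (\<Sum>j\<in>J. l j *\<^sub>R a j) \<Longrightarrow> v \<in> generated_cone a J"
  unfolding generated_cone_def by blast

lemma generated_cone_mono:
  assumes "finite I" "J \<subseteq> I"
  shows "generated_cone a J \<subseteq> generated_cone a I"
proof
  fix v assume "v \<in> generated_cone a J"
  then obtain l where l: "\<And>j. j \<in> J \<Longrightarrow> 0 \<le> l j" and v: "v = (\<Sum>j\<in>J. l j *\<^sub>R a j)"
    unfolding generated_cone_def by blast
  show "v \<in> generated_cone a I"
  proof (rule generated_coneI)
    show "0 \<le> (if j \<in> J then l j else 0)" for j using l by simp
    have "(\<Sum>i\<in>J. l i *\<^sub>R a i) = (\<Sum>i\<in>I. (if i \<in> J then l i else 0) *\<^sub>R a i)"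
      by (rule sum.mono_neutral_cong_left) (use assms in auto)
    then show "v = (\<Sum>i\<in>I. (if i \<in> J then l i else 0) *\<^sub>R a i)" using v by simp
  qed
qed

lemma generated_cone_subset_span: "generated_cone a J \<subseteq> span (a ` J)"
  unfolding generated_cone_def by (auto intro!: span_sum span_scale intro: span_base)

lemma convex_generated_cone: "convex (generated_cone a J)"
proof (rule convexI)
  fix x y and u w :: real
  assume "x \<in> generated_cone a J" "y \<in> generated_cone a J" and uw: "0 \<le> u" "0 \<le> w"
  then obtain l k where "\<And>j. j \<in> J \<Longrightarrow> 0 \<le> l j" "x = (\<Sum>j\<in>J. l j *\<^sub>R a j)"
    "\<And>j. j \<in> J \<Longrightarrow> 0 \<le> k j" "y = (\<Sum>j\<in>J. k j *\<^sub>R a j)"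
    unfolding generated_cone_def by blast
  with uw show "u *\<^sub>R x + w *\<^sub>R y \<in> generated_cone a J"
    by (intro generated_coneI[where l = "\<lambda>j. u * l j + w * k j"])
      (auto simp: scaleR_sum_right sum.distrib scaleR_add_left)
qed

lemma span_image_imp_sum:
  assumes "finite J" "v \<in> span (a ` J)"
  obtains u where "v = (\<Sum>j\<in>J. u j *\<^sub>R a j)"
  using assms
proof (induction J arbitrary: v thesis)
  case empty
  then show ?case by simp
next
  case (insert j J)
  obtain t where "v - t *\<^sub>R a j \<in> span (a ` J)"
    using insert.prems(2) span_breakdown_eq[of v "a j"] by auto
  then obtain u where u: "v - t *\<^sub>R a j = (\<Sum>j\<in>J. u j *\<^sub>R a j)" using insert.IH by blast
  have "(\<Sum>i\<in>J. (u(j := t)) i *\<^sub>R a i) = (\<Sum>i\<in>J. u i *\<^sub>R a i)"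
    using insert.hyps by (intro sum.cong) auto
  then have "v = (\<Sum>i\<in>insert j J. (u(j := t)) i *\<^sub>R a i)"
    using insert.hyps u by (simp add: algebra_simps)
  then show ?case by (rule insert.prems(1))
qed

text \<open>
  Some coefficient can be made positive by normalizing the redundant vector to have coefficient \<open>1\<close>;
  the reduction in Caratheodory's theorem needs this sign.
\<close>

lemma dependent_family_imp_relation:
  assumes "finite J" "\<not> independent_family a J"
  obtains u j where "j \<in> J" "0 < u j" "(\<Sum>k\<in>J. u k *\<^sub>R a k) = 0"
proof -
  obtain j where j: "j \<in> J" "a j \<in> span (a ` (J - {j}))"
    using assms(2) unfolding independent_family_def by blast
  obtain u where u: "a j = (\<Sum>k\<in>J - {j}. u k *\<^sub>R a k)"
    using span_image_imp_sum[OF _ j(2)] assms(1) by blast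
  have "(\<Sum>k\<in>J - {j}. (if k = j then 1 else - u k) *\<^sub>R a k) = (\<Sum>k\<in>J - {j}. - (u k *\<^sub>R a k))"
    by (rule sum.cong) auto
  then have "(\<Sum>k\<in>J. (if k = j then 1 else - u k) *\<^sub>R a k) = 0"
    using sum.remove[OF assms(1) j(1), of "\<lambda>k. (if k = j then 1 else - u k) *\<^sub>R a k"] u
    by (simp add: sum_negf)
  with j(1) show thesis by (intro that[of j "\<lambda>k. if k = j then 1 else - u k"]) auto
qed

text \<open>
  A linear relation among the generators allows the removal of one generator; this is repeated until
  the remaining generators are independent.
\<close>

lemma conic_caratheodory:
  assumes "finite I" "v \<in> generated_cone a I"
  shows "\<exists>J\<subseteq>I. independent_family a J \<and> v \<in> generated_cone a J"
  using assms
proof (induction I rule: finite_psubset_induct)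
  case (psubset I)
  show ?case
  proof (cases "independent_family a I")
    case True
    then show ?thesis using psubset.prems by blast
  next
    case False
    obtain l where l: "\<And>j. j \<in> I \<Longrightarrow> 0 \<le> l j" and v: "v = (\<Sum>j\<in>I. l j *\<^sub>R a j)"
      using psubset.prems unfolding generated_cone_def by blast
    obtain u i where i: "i \<in> I" "0 < u i" and u: "(\<Sum>k\<in>I. u k *\<^sub>R a k) = 0"
      using dependent_family_imp_relation[OF psubset.hyps False] by blast
    \<comment> \<open>Subtract the largest multiple of the relation that keeps all coefficients nonnegative;
      one coefficient vanishes.\<close>
    define P where "P = {k \<in> I. 0 < u k}"
    define t where "t = Min ((\<lambda>k. l k / u k) ` P)"
    have P: "finite P" "P \<noteq> {}" using psubset.hyps i by (auto simp: P_def)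
    then have "t \<in> (\<lambda>k. l k / u k) ` P" unfolding t_def by (intro Min_in) auto
    then obtain k where k: "k \<in> I" "0 < u k" "t = l k / u k" by (auto simp: P_def)
    have t0: "0 \<le> t" using k l by simp
    have nonneg: "0 \<le> l j - t * u j" if "j \<in> I" for j
    proof (cases "0 < u j")
      case True
      then have "t \<le> l j / u j" unfolding t_def using that P by (intro Min_le) (auto simp: P_def)
      then show ?thesis using True by (simp add: field_simps)
    next
      case False
      then have "t * u j \<le> 0" using t0 by (simp add: mult_nonneg_nonpos)
      then show ?thesis using l[OF that] by simp
    qed
    have "v = (\<Sum>j\<in>I. l j *\<^sub>R a j) - t *\<^sub>R (\<Sum>j\<in>I. u j *\<^sub>R a j)" using u v by simp
    also have "\<dots> = (\<Sum>j\<in>I. (l j - t * u j) *\<^sub>R a j)"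
      by (simp add: scaleR_sum_right scaleR_diff_left sum_subtractf)
    also have "\<dots> = (\<Sum>j\<in>I - {k}. (l j - t * u j) *\<^sub>R a j)"
      using sum.remove[OF psubset.hyps k(1), of "\<lambda>j. (l j - t * u j) *\<^sub>R a j"] k by simp
    finally have "v \<in> generated_cone a (I - {k})"
      using nonneg by (intro generated_coneI[where l = "\<lambda>j. l j - t * u j"]) auto
    moreover have "I - {k} \<subset> I" using k(1) by blast
    ultimately show ?thesis using psubset.IH[of "I - {k}"] by blast
  qed
qed

definition dual_family :: "('i \<Rightarrow> 'a::real_inner) \<Rightarrow> ('i \<Rightarrow> 'a) \<Rightarrow> 'i set \<Rightarrow> bool" where
  "dual_family d a J \<longleftrightarrow> (\<forall>j\<in>J. \<forall>k\<in>J. d j \<bullet> a k = (if j = k then 1 else 0))"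

text \<open>
  The dual vector for \<open>j\<close> is the component of \<open>a j\<close> orthogonal to the other vectors of the family,
  rescaled.
\<close>

lemma dual_family_exists:
  fixes a :: "'i \<Rightarrow> 'a::{real_inner,banach}"
  assumes "finite J" "independent_family a J"
  shows "\<exists>d. dual_family d a J"
proof -
  have "\<exists>e. \<forall>k\<in>J. e \<bullet> a k = (if j = k then 1 else 0)" if "j \<in> J" for j
  proof -
    let ?S = "span (a ` (J - {j}))"
    have "closed ?S" using assms(1) by (intro closed_finite_span) auto
    then obtain p where p: "p \<in> ?S" and orth: "\<And>w. w \<in> ?S \<Longrightarrow> (a j - p) \<bullet> w = 0"
      using orthogonal_decomposition subspace_span by blast
    define r where "r = a j - p"
    have "r \<noteq> 0" using assms(2) that p unfolding independent_family_def r_def by auto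
    then have r0: "r \<bullet> r \<noteq> 0" by simp
    have "r \<bullet> a j = r \<bullet> r" using orth[OF p] by (simp add: r_def inner_diff_right inner_diff_left)
    moreover have "r \<bullet> a k = 0" if "k \<in> J" "k \<noteq> j" for k
      using orth[of "a k"] that by (auto simp: r_def intro: span_base)
    ultimately have "\<forall>k\<in>J. (r /\<^sub>R (r \<bullet> r)) \<bullet> a k = (if j = k then 1 else 0)"
      using r0 by auto
    then show ?thesis by blast
  qed
  then show ?thesis unfolding dual_family_def by metis
qed

lemma dual_family_coefficient:
  assumes "finite J" "dual_family d a J" "j \<in> J"
  shows "d j \<bullet> (\<Sum>k\<in>J. l k *\<^sub>R a k) = l j"
proof -
  have "d j \<bullet> (\<Sum>k\<in>J. l k *\<^sub>R a k) = (\<Sum>k\<in>J. if j = k then l k else 0)"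
    unfolding inner_sum_right using assms by (intro sum.cong) (auto simp: dual_family_def)
  then show ?thesis using assms by simp
qed

text \<open>
  For a simplicial cone the coefficients are functions of the vector, so membership is described by
  one linear equation and finitely many linear inequalities.
\<close>

lemma generated_cone_iff_dual:
  assumes "finite J" "dual_family d a J"
  shows "v \<in> generated_cone a J \<longleftrightarrow>
    (\<forall>j\<in>J. 0 \<le> d j \<bullet> v) \<and> v = (\<Sum>j\<in>J. (d j \<bullet> v) *\<^sub>R a j)" (is "_ \<longleftrightarrow> ?R")
proof
  assume "v \<in> generated_cone a J"
  then obtain l where l: "\<forall>j\<in>J. 0 \<le> l j" and v: "v = (\<Sum>j\<in>J. l j *\<^sub>R a j)"
    unfolding generated_cone_def by blast
  have "d j \<bullet> v = l j" if "j \<in> J" for j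
    unfolding v by (rule dual_family_coefficient[OF assms that])
  then show ?R using l v by simp
qed (auto intro: generated_coneI)

text \<open>
  A simplicial cone is closed by its description through dual vectors, and by Caratheodory's theorem
  every finitely generated cone is a finite union of simplicial ones.
\<close>

lemma closed_generated_cone:
  fixes a :: "'i \<Rightarrow> 'a::{real_inner,banach}"
  assumes "finite I"
  shows "closed (generated_cone a I)"
proof -
  have simplicial: "closed (generated_cone a J)" if J: "J \<subseteq> I" "independent_family a J" for J
  proof -
    have fin: "finite J" using J(1) assms finite_subset by blast
    obtain d where "dual_family d a J"
      using dual_family_exists[OF fin J(2)] by blast
    then have "generated_cone a J
        = (\<Inter>j\<in>J. {v. 0 \<le> d j \<bullet> v}) \<inter> {v. v = (\<Sum>j\<in>J. (d j \<bullet> v) *\<^sub>R a j)}"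
      using generated_cone_iff_dual[OF fin] by blast
    then show ?thesis
      by (auto intro!: closed_Int closed_INT closed_Collect_le closed_Collect_eq continuous_intros)
  qed
  have "generated_cone a I = (\<Union>J\<in>{J. J \<subseteq> I \<and> independent_family a J}. generated_cone a J)"
  proof (intro equalityI subsetI)
    fix v assume "v \<in> generated_cone a I"
    then show "v \<in> (\<Union>J\<in>{J. J \<subseteq> I \<and> independent_family a J}. generated_cone a J)"
      using conic_caratheodory[OF assms, of v a] by auto
  next
    fix v assume "v \<in> (\<Union>J\<in>{J. J \<subseteq> I \<and> independent_family a J}. generated_cone a J)"
    then show "v \<in> generated_cone a I" using generated_cone_mono[OF assms, of _ a] by auto
  qed
  also have "closed \<dots>" using assms simplicial by (intro closed_UN) auto
  finally show ?thesis .
qed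

text \<open>
  Coefficients with respect to an independent family are inner products with the dual vectors, hence
  bounded by the norm of the vector. There are only finitely many independent subfamilies, so one
  constant serves for all of them.
\<close>

lemma bounded_cone_coefficients:
  fixes a :: "'i \<Rightarrow> 'a::{real_inner,banach}"
  assumes "finite I"
  shows "\<exists>c\<ge>0. \<forall>J v. J \<subseteq> I \<longrightarrow> v \<in> generated_cone a J \<longrightarrow>
    (\<exists>J' l. J' \<subseteq> J \<and> (\<forall>j\<in>J'. 0 \<le> l j) \<and> v = (\<Sum>j\<in>J'. l j *\<^sub>R a j) \<and> sum l J' \<le> c * norm v)"
proof -
  have "\<exists>d. \<forall>J. J \<subseteq> I \<and> independent_family a J \<longrightarrow> dual_family (d J) a J"
    using dual_family_exists[of _ a] finite_subset[OF _ assms] by metis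
  then obtain d where d: "\<And>J. J \<subseteq> I \<Longrightarrow> independent_family a J \<Longrightarrow> dual_family (d J) a J" by blast
  define c where "c = (\<Sum>J\<in>Pow I. \<Sum>j\<in>J. norm (d J j))"
  have c0: "0 \<le> c" unfolding c_def by (intro sum_nonneg) auto
  have "\<exists>J' l. J' \<subseteq> J \<and> (\<forall>j\<in>J'. 0 \<le> l j) \<and> v = (\<Sum>j\<in>J'. l j *\<^sub>R a j) \<and> sum l J' \<le> c * norm v"
    if J: "J \<subseteq> I" and v: "v \<in> generated_cone a J" for J v
  proof -
    obtain J' where J': "J' \<subseteq> J" "independent_family a J'" and vJ': "v \<in> generated_cone a J'"
      using conic_caratheodory[OF finite_subset[OF J assms] v] by blast
    have J'I: "J' \<subseteq> I" using J J'(1) by simp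
    then have fin: "finite J'" using assms by (rule finite_subset)
    obtain l where l: "\<forall>j\<in>J'. 0 \<le> l j" and vl: "v = (\<Sum>j\<in>J'. l j *\<^sub>R a j)"
      using vJ' unfolding generated_cone_def by blast
    have "sum l J' = (\<Sum>j\<in>J'. d J' j \<bullet> v)"
      unfolding vl using dual_family_coefficient[OF fin d[OF J'I J'(2)], of _ l] by simp
    also have "\<dots> \<le> (\<Sum>j\<in>J'. norm (d J' j) * norm v)"
      by (intro sum_mono norm_cauchy_schwarz)
    also have "\<dots> = (\<Sum>j\<in>J'. norm (d J' j)) * norm v" by (simp add: sum_distrib_right)
    also have "\<dots> \<le> c * norm v"
      unfolding c_def using assms J'I
      by (intro mult_right_mono member_le_sum[where f = "\<lambda>J. \<Sum>j\<in>J. norm (d J j)"])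
        (auto intro: sum_nonneg)
    finally show ?thesis using J'(1) l vl by blast
  qed
  note representation = this
  show ?thesis by (intro exI[of _ c] conjI[OF c0] allI impI) (rule representation)
qed

text \<open>
  This is Farkas' lemma: the cone of the active normals is closed, so a vector outside it
  has a nonzero residue \<open>w\<close> after projection onto the cone, and \<open>w\<close> contradicts normality.
\<close>

lemma normal_cone_polyhedron:
  fixes a :: "'i \<Rightarrow> 'a::{real_inner,banach}"
  assumes fin: "finite I" and p: "\<And>i. i \<in> I \<Longrightarrow> a i \<bullet> p \<le> \<beta> i"
    and v: "\<And>z. (\<And>i. i \<in> I \<Longrightarrow> a i \<bullet> z \<le> \<beta> i) \<Longrightarrow> v \<bullet> (z - p) \<le> 0"
  shows "v \<in> generated_cone a {i \<in> I. a i \<bullet> p = \<beta> i}"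
proof -
  define A where "A = {i \<in> I. a i \<bullet> p = \<beta> i}"
  let ?K = "generated_cone a A"
  have finA: "finite A" using fin by (simp add: A_def)
  have zero: "0 \<in> ?K" by (rule generated_coneI[where l = "\<lambda>_. 0"]) auto
  obtain k where k: "k \<in> ?K" and obtuse: "\<And>z. z \<in> ?K \<Longrightarrow> (v - k) \<bullet> (z - k) \<le> 0"
    using projection_exists[OF closed_generated_cone[OF finA] convex_generated_cone] zero by blast
  \<comment> \<open>If \<open>v\<close> were not in the cone, \<open>w\<close> would be a feasible direction at \<open>p\<close> along which
    \<open>v\<close> increases.\<close>
  define w where "w = v - k"
  have wa: "a i \<bullet> w \<le> 0" if "i \<in> A" for i
  proof -
    obtain l where l: "\<forall>j\<in>A. 0 \<le> l j" and kl: "k = (\<Sum>j\<in>A. l j *\<^sub>R a j)"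
      using k unfolding generated_cone_def by blast
    have "(\<Sum>j\<in>A. (if j = i then 1 else 0) *\<^sub>R a j) = (\<Sum>j\<in>A. if j = i then a j else 0)"
      by (rule sum.cong) auto
    then have "k + a i = (\<Sum>j\<in>A. (l j + (if j = i then 1 else 0)) *\<^sub>R a j)"
      using that finA by (simp add: kl scaleR_add_left sum.distrib)
    then have "k + a i \<in> ?K"
      using l by (intro generated_coneI[where l = "\<lambda>j. l j + (if j = i then 1 else 0)"]) auto
    then show ?thesis using obtuse[of "k + a i"] by (simp add: w_def inner_commute)
  qed
  have "\<exists>s>0. \<forall>t. 0 < t \<and> t \<le> s \<longrightarrow> a i \<bullet> (p + t *\<^sub>R w) \<le> \<beta> i" if "i \<in> I" for i
  proof (cases "i \<in> A")
    case True
    have "t * (a i \<bullet> w) \<le> 0" if "0 < t" for t using wa[OF True] that by (simp add: mult_nonneg_nonpos)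
    then have "a i \<bullet> (p + t *\<^sub>R w) \<le> \<beta> i" if "0 < t" for t
      using p[OF \<open>i \<in> I\<close>] that by (force simp: inner_add_right)
    then show ?thesis by (auto intro: exI[of _ 1])
  next
    case False
    then have gap: "0 < \<beta> i - a i \<bullet> p" using p[OF that] that by (simp add: A_def less_le)
    define s where "s = (\<beta> i - a i \<bullet> p) / (1 + \<bar>a i \<bullet> w\<bar>)"
    have "s > 0" using gap by (simp add: s_def add_pos_nonneg)
    moreover have "a i \<bullet> (p + t *\<^sub>R w) \<le> \<beta> i" if "0 < t" "t \<le> s" for t
    proof -
      have "t * (a i \<bullet> w) \<le> t * (1 + \<bar>a i \<bullet> w\<bar>)"
        using that by (intro mult_left_mono) auto
      also have "\<dots> \<le> s * (1 + \<bar>a i \<bullet> w\<bar>)"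
        using that by (intro mult_right_mono) auto
      also have "\<dots> = \<beta> i - a i \<bullet> p" by (simp add: s_def add_pos_nonneg less_imp_neq[symmetric])
      finally show ?thesis by (simp add: inner_add_right)
    qed
    ultimately show ?thesis by blast
  qed
  then obtain s where s: "\<And>i. i \<in> I \<Longrightarrow> 0 < s i"
    and feas: "\<And>i t. i \<in> I \<Longrightarrow> 0 < t \<Longrightarrow> t \<le> s i \<Longrightarrow> a i \<bullet> (p + t *\<^sub>R w) \<le> \<beta> i"
    by metis
  define t where "t = Min (insert 1 (s ` I))"
  have t0: "0 < t" using fin s by (simp add: t_def)
  have "a i \<bullet> (p + t *\<^sub>R w) \<le> \<beta> i" if "i \<in> I" for i
    using feas[OF that t0] fin that by (simp add: t_def)
  then have "v \<bullet> ((p + t *\<^sub>R w) - p) \<le> 0" by (rule v)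
  then have "v \<bullet> w \<le> 0" using t0 by (simp add: mult_le_0_iff)
  moreover have "0 \<le> k \<bullet> w" using obtuse[OF zero] by (simp add: w_def inner_commute)
  moreover have "w \<bullet> w = v \<bullet> w - k \<bullet> w" by (simp add: w_def inner_diff_left)
  ultimately have "w \<bullet> w \<le> 0" by simp
  then have "w = 0" by (metis inner_eq_zero_iff inner_ge_zero order_antisym)
  then have "v = k" by (simp add: w_def)
  then show ?thesis using k by (simp add: A_def)
qed

lemma closed_polyhedron:
  fixes a :: "'i \<Rightarrow> 'a::real_inner"
  shows "closed {z. \<forall>i\<in>I. a i \<bullet> z \<le> \<beta> i}"
proof -
  have "{z. \<forall>i\<in>I. a i \<bullet> z \<le> \<beta> i} = (\<Inter>i\<in>I. {z. a i \<bullet> z \<le> \<beta> i})" by blast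
  then show ?thesis by (auto intro: closed_halfspace_le)
qed

lemma convex_polyhedron:
  fixes a :: "'i \<Rightarrow> 'a::real_inner"
  shows "convex {z. \<forall>i\<in>I. a i \<bullet> z \<le> \<beta> i}"
proof -
  have "{z. \<forall>i\<in>I. a i \<bullet> z \<le> \<beta> i} = (\<Inter>i\<in>I. {z. a i \<bullet> z \<le> \<beta> i})" by blast
  then show ?thesis by (auto intro: convex_INT convex_halfspace_le)
qed

text \<open>
  Let \<open>p\<close> be the projection of \<open>x\<close> onto the polyhedron. Then \<open>x - p\<close> is a nonnegative combination of
  normals that are active at \<open>p\<close>, and pairing it with itself bounds its squared norm by
  \<open>\<delta>\<close> times the sum of the coefficients, which is at most a constant times its norm. The
  constant depends on the normals only. That \<open>x - p\<close> lies in their span allows an application inside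
  a subspace containing the normals.
\<close>

lemma hoffman_error_bound:
  fixes a :: "'i \<Rightarrow> 'a::{real_inner,banach}"
  assumes fin: "finite I"
  shows "\<exists>c\<ge>0. \<forall>\<beta> \<delta> x x0. (\<forall>i\<in>I. a i \<bullet> x0 \<le> \<beta> i) \<longrightarrow> 0 \<le> \<delta> \<longrightarrow> (\<forall>i\<in>I. a i \<bullet> x \<le> \<beta> i + \<delta>) \<longrightarrow>
    (\<exists>p. (\<forall>i\<in>I. a i \<bullet> p \<le> \<beta> i) \<and> x - p \<in> span (a ` I) \<and> norm (x - p) \<le> c * \<delta>)"
proof -
  obtain c where c0: "c \<ge> 0" and c: "\<forall>J v. J \<subseteq> I \<longrightarrow> v \<in> generated_cone a J \<longrightarrow>
    (\<exists>J' l. J' \<subseteq> J \<and> (\<forall>j\<in>J'. 0 \<le> l j) \<and> v = (\<Sum>j\<in>J'. l j *\<^sub>R a j) \<and> sum l J' \<le> c * norm v)"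
    using bounded_cone_coefficients[OF fin, of a] by (elim exE conjE) (rule that)
  have "\<exists>p. (\<forall>i\<in>I. a i \<bullet> p \<le> \<beta> i) \<and> x - p \<in> span (a ` I) \<and> norm (x - p) \<le> c * \<delta>"
    if x0: "\<forall>i\<in>I. a i \<bullet> x0 \<le> \<beta> i" and \<delta>: "0 \<le> \<delta>" and x: "\<forall>i\<in>I. a i \<bullet> x \<le> \<beta> i + \<delta>"
    for \<beta> \<delta> x x0
  proof -
    define P where "P = {z. \<forall>i\<in>I. a i \<bullet> z \<le> \<beta> i}"
    have "closed P" "convex P" "P \<noteq> {}"
      using x0 by (auto simp: P_def closed_polyhedron convex_polyhedron)
    then obtain p where pP: "p \<in> P" and "\<And>z. z \<in> P \<Longrightarrow> (x - p) \<bullet> (z - p) \<le> 0"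
      using projection_exists[of P x] by blast
    then have p: "\<forall>i\<in>I. a i \<bullet> p \<le> \<beta> i"
      and obtuse: "\<And>z. \<forall>i\<in>I. a i \<bullet> z \<le> \<beta> i \<Longrightarrow> (x - p) \<bullet> (z - p) \<le> 0"
      by (auto simp: P_def)
    have cone: "x - p \<in> generated_cone a {i \<in> I. a i \<bullet> p = \<beta> i}"
      using p obtuse by (intro normal_cone_polyhedron[OF fin]) auto
    have "norm (x - p) \<le> c * \<delta>"
    proof (cases "x = p")
      case True
      then show ?thesis using c0 \<delta> by simp
    next
      case False
      obtain J l where J: "J \<subseteq> {i \<in> I. a i \<bullet> p = \<beta> i}" and l: "\<And>j. j \<in> J \<Longrightarrow> 0 \<le> l j"
        and eq: "x - p = (\<Sum>j\<in>J. l j *\<^sub>R a j)" and bound: "sum l J \<le> c * norm (x - p)"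
        using c[rule_format, OF _ cone] by blast
      have "(norm (x - p))\<^sup>2 = (\<Sum>j\<in>J. l j *\<^sub>R a j) \<bullet> (x - p)"
        unfolding power2_norm_eq_inner by (simp flip: eq)
      also have "\<dots> = (\<Sum>j\<in>J. l j * (a j \<bullet> (x - p)))" by (simp add: inner_sum_left)
      also have "\<dots> \<le> (\<Sum>j\<in>J. l j * \<delta>)"
      proof (intro sum_mono mult_left_mono l)
        fix j assume "j \<in> J"
        then have "j \<in> I" "a j \<bullet> p = \<beta> j" using J by auto
        then show "a j \<bullet> (x - p) \<le> \<delta>" using bspec[OF x \<open>j \<in> I\<close>] by (simp add: inner_diff_right)
      qed
      also have "\<dots> = sum l J * \<delta>" by (simp add: sum_distrib_right)
      also have "\<dots> \<le> c * norm (x - p) * \<delta>" using bound \<delta> by (rule mult_right_mono)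
      finally have "norm (x - p) * norm (x - p) \<le> norm (x - p) * (c * \<delta>)"
        by (simp add: power2_eq_square mult_ac)
      then show ?thesis using False by simp
    qed
    moreover have "x - p \<in> span (a ` I)"
      using cone generated_cone_subset_span[of a "{i \<in> I. a i \<bullet> p = \<beta> i}"]
        span_mono[of "a ` {i \<in> I. a i \<bullet> p = \<beta> i}" "a ` I"] by blast
    ultimately show ?thesis using p by blast
  qed
  note solution = this
  show ?thesis by (intro exI[of _ c] conjI[OF c0] allI impI) (rule solution)
qed

section \<open>Error bounds for operators with closed range\<close>

text \<open>
  This is the open mapping theorem in quantitative form. The closed range is a complete space covered
  by the closures of the images of balls, so by Baire's theorem one of these closures has
  interior points. Thus every \<open>w\<close> in the range is approximated within half of its norm by an image of
  a point of comparable norm, and iterating on the remainder gives a geometric series.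
\<close>

lemma bounded_linear_right_inverse:
  fixes T :: "'a::banach \<Rightarrow> 'b::banach"
  assumes "bounded_linear T" "closed (range T)"
  shows "\<exists>K\<ge>0. \<forall>w\<in>range T. \<exists>x. T x = w \<and> norm x \<le> K * norm w"
proof -
  interpret T: bounded_linear T by fact
  let ?W = "range T"
  have W: "subspace ?W" using T.linear linear_subspace_image subspace_UNIV by blast
  define G where "G n = closure (T ` cball 0 (real n))" for n
  have G_sub: "G n \<subseteq> ?W" for n
    unfolding G_def using assms(2) by (intro closure_minimal) auto
  have "\<Union> (range G) = ?W"
  proof (intro equalityI subsetI)
    fix w assume "w \<in> ?W"
    then obtain x where x: "w = T x" by blast
    obtain n where "norm x \<le> real n" using real_arch_simple by blast
    then have "w \<in> G n" unfolding G_def x by (intro closure_subset[THEN subsetD]) auto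
    then show "w \<in> \<Union> (range G)" by blast
  qed (use G_sub in blast)
  moreover have "top_of_set ?W interior_of ?W \<noteq> {}"
    using interior_of_topspace[of "top_of_set ?W"] by auto
  ultimately have "top_of_set ?W interior_of \<Union> (range G) \<noteq> {}" by simp
  moreover have "completely_metrizable_space (top_of_set ?W)"
    using assms(2) completely_metrizable_space_closedin completely_metrizable_space_euclidean
      closed_closedin by blast
  moreover have "closedin (top_of_set ?W) (G n)" for n
    using G_sub by (simp add: G_def closed_subset)
  ultimately obtain n where "top_of_set ?W interior_of (G n) \<noteq> {}"
    using Baire_category_alt[of "top_of_set ?W" "range G"] by auto
  then obtain U w0 where "openin (top_of_set ?W) U" and w0U: "w0 \<in> U" and UG: "U \<subseteq> G n"
    unfolding interior_of_def by blast
  then obtain e where e: "0 < e" and ball_G: "ball w0 e \<inter> ?W \<subseteq> G n" and w0: "w0 \<in> ?W"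
    unfolding openin_contains_ball by blast
  \<comment> \<open>Differences of points of the ball around \<open>w0\<close> cover a ball around the origin.\<close>
  have near: "\<exists>x. norm x \<le> 2 * real n \<and> norm (w - T x) < \<epsilon>"
    if w: "w \<in> ?W" "norm w < e" and \<epsilon>: "0 < \<epsilon>" for w \<epsilon>
  proof -
    have "w0 + w \<in> ball w0 e \<inter> ?W" "w0 \<in> ball w0 e \<inter> ?W"
      using e w(2) w0 subspace_add[OF W w0 w(1)] by (simp_all add: dist_norm)
    then have "w0 + w \<in> G n" "w0 \<in> G n" using ball_G by blast+
    then have "\<exists>z\<in>T ` cball 0 (real n). dist z (w0 + w) < \<epsilon> / 2"
      "\<exists>z\<in>T ` cball 0 (real n). dist z w0 < \<epsilon> / 2"
      using half_gt_zero[OF \<epsilon>] unfolding G_def closure_approachable by blast+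
    then obtain x y where x: "norm x \<le> n" "dist (T x) (w0 + w) < \<epsilon> / 2"
      and y: "norm y \<le> n" "dist (T y) w0 < \<epsilon> / 2" by auto
    have "norm (x - y) \<le> 2 * real n" using norm_triangle_ineq4[of x y] x y by linarith
    moreover have "w - T (x - y) = (T y - w0) - (T x - (w0 + w))" by (simp add: T.diff)
    then have "norm (w - T (x - y)) \<le> norm (T y - w0) + norm (T x - (w0 + w))"
      by (simp only: norm_triangle_ineq4)
    then have "norm (w - T (x - y)) < \<epsilon>" using x(2) y(2) unfolding dist_norm by linarith
    ultimately show ?thesis by blast
  qed
  define K where "K = 4 * real n / e"
  have K0: "0 \<le> K" using e by (simp add: K_def)
  have halve: "\<exists>x. norm x \<le> K * norm w \<and> norm (w - T x) \<le> norm w / 2" if w: "w \<in> ?W" for w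
  proof (cases "w = 0")
    case True
    then show ?thesis by (intro exI[of _ 0]) (simp add: T.zero)
  next
    case False
    \<comment> \<open>Dividing by \<open>s\<close> brings \<open>w\<close> to norm \<open>e / 2\<close>, where \<open>near\<close> applies with error \<open>e / 4\<close>.\<close>
    define s where "s = 2 * norm w / e"
    have s: "0 < s" using False e by (simp add: s_def)
    have "norm (w /\<^sub>R s) < e" using False e by (simp add: s_def field_simps)
    then obtain x where x: "norm x \<le> 2 * real n" "norm (w /\<^sub>R s - T x) < e / 4"
      using near[of "w /\<^sub>R s" "e / 4"] subspace_scale[OF W w] e by auto
    have "norm (s *\<^sub>R x) \<le> s * (2 * real n)" using s x by simp
    also have "\<dots> = K * norm w" by (simp add: s_def K_def)
    finally have "norm (s *\<^sub>R x) \<le> K * norm w" .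
    moreover have "w - T (s *\<^sub>R x) = s *\<^sub>R (w /\<^sub>R s - T x)"
      using s by (simp add: T.scaleR algebra_simps)
    then have "norm (w - T (s *\<^sub>R x)) \<le> s * (e / 4)" using s x by simp
    then have "norm (w - T (s *\<^sub>R x)) \<le> norm w / 2" using e by (simp add: s_def)
    ultimately show ?thesis by blast
  qed
  then obtain g where g: "\<And>w. w \<in> ?W \<Longrightarrow> norm (g w) \<le> K * norm w"
    "\<And>w. w \<in> ?W \<Longrightarrow> norm (w - T (g w)) \<le> norm w / 2" by metis
  have "\<exists>x. T x = w \<and> norm x \<le> (2 * K) * norm w" if w: "w \<in> ?W" for w
  proof -
    define r where "r k = ((\<lambda>v. v - T (g v)) ^^ k) w" for k
    have r0: "r 0 = w" and rSuc: "r (Suc k) = r k - T (g (r k))" for k by (simp_all add: r_def)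
    have rW: "r k \<in> ?W" for k
      by (induction k) (use w W in \<open>auto simp: r0 rSuc intro: subspace_diff\<close>)
    have r_le: "norm (r k) \<le> norm w * (1/2) ^ k" for k
    proof (induction k)
      case (Suc k)
      then show ?case using g(2)[OF rW[of k]] by (simp add: rSuc)
    qed (simp add: r0)
    have geo: "(\<lambda>k. K * norm w * (1/2) ^ k) sums (K * norm w * 2)"
      using sums_mult[OF geometric_sums[of "1/2::real"], of "K * norm w"] by simp
    have s_le: "norm (g (r k)) \<le> K * norm w * (1/2) ^ k" for k
      using g(1)[OF rW[of k]] mult_left_mono[OF r_le[of k] K0] by (simp add: mult.assoc)
    have sm: "summable (\<lambda>k. norm (g (r k)))"
      using s_le by (intro summable_comparison_test'[OF sums_summable[OF geo], of 0]) auto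
    have "(\<lambda>k. norm w * (1/2) ^ k) \<longlonglongrightarrow> norm w * 0"
      by (intro tendsto_mult tendsto_const LIMSEQ_power_zero) auto
    then have "r \<longlonglongrightarrow> 0" using r_le by (intro Lim_null_comparison[of r]) auto
    then have "(\<lambda>k. r k - r (Suc k)) sums (r 0 - 0)" by (rule telescope_sums')
    then have "(\<lambda>k. T (g (r k))) sums w" by (simp add: rSuc r0)
    moreover have "(\<lambda>k. T (g (r k))) sums T (\<Sum>k. g (r k))"
      by (rule T.sums[OF summable_sums[OF summable_norm_cancel[OF sm]]])
    ultimately have "T (\<Sum>k. g (r k)) = w" using sums_unique2 by blast
    moreover have "norm (\<Sum>k. g (r k)) \<le> (\<Sum>k. K * norm w * (1/2) ^ k)"
      using summable_norm[OF sm] suminf_le[OF s_le sm sums_summable[OF geo]] by linarith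
    then have "norm (\<Sum>k. g (r k)) \<le> (2 * K) * norm w" using sums_unique[OF geo] by simp
    ultimately show ?thesis by blast
  qed
  note preimage = this
  show ?thesis
  proof (intro exI[of _ "2 * K"] conjI ballI)
    show "0 \<le> 2 * K" using K0 by simp
  qed (rule preimage)
qed

text \<open>
  The point \<open>x\<close> is first shifted by a vector of norm of order \<open>\<delta>\<close> so that the equation holds. The
  remaining violation of the inequalities, still of order \<open>\<delta>\<close>, is removed by the Hoffman bound in
  the kernel \<open>N\<close> of \<open>T\<close>, with the functionals represented by vectors of \<open>N\<close>.
\<close>

lemma hoffman_error_bound_closed_range:
  fixes T :: "'a::{real_inner,banach} \<Rightarrow> 'b::banach" and f :: "'i \<Rightarrow> 'a \<Rightarrow> real"
  assumes "bounded_linear T" "closed (range T)" and fin: "finite I"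
    and bl: "\<forall>i\<in>I. bounded_linear (f i)"
  shows "\<exists>c>0. \<forall>\<beta> \<delta> x x0. (\<forall>i\<in>I. f i x0 \<le> \<beta> i) \<longrightarrow> 0 \<le> \<delta> \<longrightarrow>
    norm (T x - T x0) \<le> \<delta> \<longrightarrow> (\<forall>i\<in>I. f i x \<le> \<beta> i + \<delta>) \<longrightarrow>
    (\<exists>p. T p = T x0 \<and> (\<forall>i\<in>I. f i p \<le> \<beta> i) \<and> norm (x - p) \<le> c * \<delta>)"
proof -
  interpret T: bounded_linear T by fact
  note f = bspec[OF bl]
  define N where "N = {x. T x = 0}"
  have N: "closed N" "subspace N"
    unfolding N_def
    by (auto intro!: closed_Collect_eq continuous_intros T.continuous_on
        simp: subspace_def T.add T.scaleR T.zero)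
  have "\<exists>a. \<forall>i\<in>I. a i \<in> N \<and> (\<forall>x\<in>N. f i x = a i \<bullet> x)"
    using riesz_representation_on_subspace[OF N f] by (intro bchoice) blast
  then obtain a where aN: "\<And>i. i \<in> I \<Longrightarrow> a i \<in> N"
    and a: "\<And>i x. i \<in> I \<Longrightarrow> x \<in> N \<Longrightarrow> f i x = a i \<bullet> x" by blast
  have spanN: "span (a ` I) \<subseteq> N" using aN N(2) by (intro span_minimal) auto
  obtain K where K0: "0 \<le> K" and K: "\<And>w. w \<in> range T \<Longrightarrow> \<exists>x. T x = w \<and> norm x \<le> K * norm w"
    using bounded_linear_right_inverse[OF assms(1,2)] by blast
  obtain h where h0: "0 \<le> h" and hoffman: "\<forall>\<beta> \<delta> x x0. (\<forall>i\<in>I. a i \<bullet> x0 \<le> \<beta> i) \<longrightarrow> 0 \<le> \<delta> \<longrightarrow>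
      (\<forall>i\<in>I. a i \<bullet> x \<le> \<beta> i + \<delta>) \<longrightarrow>
      (\<exists>p. (\<forall>i\<in>I. a i \<bullet> p \<le> \<beta> i) \<and> x - p \<in> span (a ` I) \<and> norm (x - p) \<le> h * \<delta>)"
    using hoffman_error_bound[OF fin, of a] by (elim exE conjE) (rule that)
  define L where "L = (\<Sum>i\<in>I. onorm (f i))"
  have L: "f i u \<le> L * norm u" if "i \<in> I" for i u
  proof -
    have "f i u \<le> onorm (f i) * norm u" using onorm[OF f[OF that], of u] by simp
    also have "\<dots> \<le> L * norm u"
      unfolding L_def using that fin f
      by (intro mult_right_mono member_le_sum) (auto intro: onorm_pos_le)
    finally show ?thesis .
  qed
  have L0: "0 \<le> L" unfolding L_def using f by (auto intro!: sum_nonneg onorm_pos_le)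
  \<comment> \<open>The summand \<open>K\<close> accounts for the shift, \<open>h * (1 + L * K)\<close> for the correction in the kernel,
    and \<open>1\<close> makes the constant positive.\<close>
  define c where "c = h * (1 + L * K) + K + 1"
  have c0: "0 < c" using h0 L0 K0 by (simp add: c_def add_nonneg_pos)
  have solution: "\<exists>p. T p = T x0 \<and> (\<forall>i\<in>I. f i p \<le> \<beta> i) \<and> norm (x - p) \<le> c * \<delta>"
    if x0: "\<forall>i\<in>I. f i x0 \<le> \<beta> i" and \<delta>: "0 \<le> \<delta>" and Tx: "norm (T x - T x0) \<le> \<delta>"
      and x: "\<forall>i\<in>I. f i x \<le> \<beta> i + \<delta>" for \<beta> \<delta> x x0
  proof -
    obtain u where u: "T u = T (x0 - x)" "norm u \<le> K * norm (T (x0 - x))" using K by blast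
    have "norm (T (x0 - x)) \<le> \<delta>" using Tx by (simp add: T.diff norm_minus_commute)
    then have u_le: "norm u \<le> K * \<delta>" using u(2) K0 by (meson mult_left_mono order_trans)
    define n where "n = x + u - x0"
    have nN: "n \<in> N" using u(1) by (simp add: N_def n_def T.add T.diff)
    have 1: "\<forall>i\<in>I. a i \<bullet> 0 \<le> \<beta> i - f i x0" using x0 by simp
    have 2: "\<forall>i\<in>I. a i \<bullet> n \<le> (\<beta> i - f i x0) + (1 + L * K) * \<delta>"
    proof
      fix i assume i: "i \<in> I"
      interpret fi: bounded_linear "f i" using f[OF i] .
      have "a i \<bullet> n = f i x + f i u - f i x0"
        using a[OF i nN] by (simp add: n_def fi.add fi.diff)
      moreover have "f i u \<le> L * K * \<delta>"
        using L[OF i, of u] mult_left_mono[OF u_le L0] by (simp add: mult.assoc)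
      moreover have "f i x \<le> \<beta> i + \<delta>" using x i by blast
      ultimately show "a i \<bullet> n \<le> (\<beta> i - f i x0) + (1 + L * K) * \<delta>" by (simp add: algebra_simps)
    qed
    have 3: "0 \<le> (1 + L * K) * \<delta>" using L0 K0 \<delta> by simp
    obtain p where p: "\<forall>i\<in>I. a i \<bullet> p \<le> \<beta> i - f i x0" "n - p \<in> span (a ` I)"
      "norm (n - p) \<le> h * ((1 + L * K) * \<delta>)"
      using hoffman[rule_format, of 0 "\<lambda>i. \<beta> i - f i x0" "(1 + L * K) * \<delta>" n] 1 2 3 by auto
    have pN: "p \<in> N" using subspace_diff[OF N(2) nN, of "n - p"] p(2) spanN by auto
    have "T (x0 + p) = T x0" using pN by (simp add: N_def T.add)
    moreover have "\<forall>i\<in>I. f i (x0 + p) \<le> \<beta> i"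
      using p(1) a[OF _ pN] f by (force simp: linear_add[OF bounded_linear.linear])
    moreover have "norm (x - (x0 + p)) \<le> c * \<delta>"
    proof -
      have "x - (x0 + p) = (n - p) - u" by (simp add: n_def)
      then have "norm (x - (x0 + p)) \<le> norm (n - p) + norm u" by (simp only: norm_triangle_ineq4)
      also have "\<dots> \<le> c * \<delta>" using p(3) u_le \<delta> by (simp add: c_def algebra_simps)
      finally show ?thesis .
    qed
    ultimately show ?thesis by blast
  qed
  show ?thesis by (intro exI[of _ c] conjI[OF c0] allI impI) (rule solution)
qed

section \<open>Upper Lipschitz continuity from Lipschitz continuity on the domain\<close>

lemma mem_plus_scaled_cball:
  fixes x z :: "'a::real_normed_vector"
  assumes "z \<in> S" "norm (x - z) \<le> r"
  shows "x \<in> S + (\<lambda>b. r *\<^sub>R b) ` cball 0 1"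
proof -
  have "x - z \<in> (\<lambda>b. r *\<^sub>R b) ` cball 0 1"
  proof (cases "r = 0")
    case True
    then show ?thesis using assms(2) by (auto intro!: image_eqI[of _ _ 0])
  next
    case False
    then have "0 < r" using assms(2) norm_ge_zero[of "x - z"] by linarith
    then have "norm ((x - z) /\<^sub>R r) \<le> 1" using assms(2) unfolding norm_scaleR by (simp add: field_simps)
    then show ?thesis using \<open>0 < r\<close> by (intro image_eqI[of _ _ "(x - z) /\<^sub>R r"]) auto
  qed
  from set_plus_intro[OF assms(1) this] show ?thesis by simp
qed

lemma convergent_if_steps_geometric:
  fixes x :: "nat \<Rightarrow> 'a::banach"
  assumes "\<And>n. norm (x n - x (Suc n)) \<le> b * (1/2) ^ n"
  shows "convergent x"
proof -
  have "summable (\<lambda>n. b * (1/2::real) ^ n)" by (intro summable_mult summable_geometric) simp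
  then have "summable (\<lambda>n. x (Suc n) - x n)"
    using assms by (elim summable_comparison_test') (simp add: norm_minus_commute)
  then have "(\<lambda>n. x 0 + (\<Sum>k<n. x (Suc k) - x k)) \<longlonglongrightarrow> x 0 + (\<Sum>n. x (Suc n) - x n)"
    by (intro tendsto_add tendsto_const summable_LIMSEQ)
  then show ?thesis by (simp add: sum_lessThan_telescope convergentI)
qed

text \<open>
  The case that needs an argument is \<open>F y0 = {}\<close>. If \<open>y0\<close> were a limit of points with nonempty values,
  the Lipschitz property would select, along a rapidly converging sequence, a Cauchy sequence of
  values, whose limit would belong to \<open>F y0\<close> since the graph is closed.
\<close>

lemma locally_upper_lipschitzian_if_lipschitz_on_domain:
  fixes F :: "'b::real_normed_vector \<Rightarrow> 'a::banach set"
  assumes c: "0 < c" and graph: "closed {p. snd p \<in> F (fst p)}"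
    and lip: "\<And>y x y'. x \<in> F y \<Longrightarrow> F y' \<noteq> {} \<Longrightarrow> \<exists>x'\<in>F y'. norm (x - x') \<le> c * norm (y - y')"
  shows "locally_upper_lipschitzian_at F y0 c"
proof (cases "F y0 = {}")
  case False
  have "F y \<subseteq> F y0 + (\<lambda>b. (c * norm (y - y0)) *\<^sub>R b) ` cball 0 1" for y
    using lip[OF _ False] mem_plus_scaled_cball by blast
  then show ?thesis unfolding locally_upper_lipschitzian_at_def using c zero_less_one by blast
next
  case empty: True
  have "\<exists>\<epsilon>>0. \<forall>y\<in>ball y0 \<epsilon>. F y = {}"
  proof (rule ccontr)
    assume contra: "\<not> (\<exists>\<epsilon>>0. \<forall>y\<in>ball y0 \<epsilon>. F y = {})"
    have "\<exists>y. dist y0 y < (1/2) ^ n \<and> F y \<noteq> {}" for n :: nat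
    proof (rule ccontr)
      assume "\<not> (\<exists>y. dist y0 y < (1/2) ^ n \<and> F y \<noteq> {})"
      then have "\<forall>y\<in>ball y0 ((1/2) ^ n). F y = {}" by simp
      moreover have "(0::real) < (1/2) ^ n" by simp
      ultimately show False using contra by blast
    qed
    then obtain y where y: "\<And>n. dist y0 (y n) < (1/2) ^ n" and ne: "\<And>n. F (y n) \<noteq> {}" by metis
    have "\<exists>x. \<forall>n. x n \<in> F (y n) \<and> norm (x n - x (Suc n)) \<le> c * norm (y n - y (Suc n))"
      by (rule dependent_nat_choice) (use ne lip[OF _ ne] in blast)+
    then obtain x where x: "\<And>n. x n \<in> F (y n)"
      and step: "\<And>n. norm (x n - x (Suc n)) \<le> c * norm (y n - y (Suc n))" by blast
    have "norm (x n - x (Suc n)) \<le> (2 * c) * (1/2) ^ n" for n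
    proof -
      have "norm (y n - y (Suc n)) \<le> dist y0 (y n) + dist y0 (y (Suc n))"
        by (metis dist_norm dist_triangle3)
      also have "\<dots> \<le> (1/2) ^ n + (1/2) ^ Suc n" using y[of n] y[of "Suc n"] by linarith
      also have "\<dots> \<le> 2 * (1/2) ^ n" by simp
      finally have "c * norm (y n - y (Suc n)) \<le> c * (2 * (1/2) ^ n)" using c by simp
      then show ?thesis using step[of n] by simp
    qed
    then obtain l where l: "x \<longlonglongrightarrow> l" using convergent_if_steps_geometric convergentD by blast
    have "(\<lambda>n. (1/2::real) ^ n) \<longlonglongrightarrow> 0" by (intro LIMSEQ_power_zero) simp
    then have "(\<lambda>n. dist (y n) y0) \<longlonglongrightarrow> 0"
      using y[THEN less_imp_le]
      by (intro Lim_null_comparison[of "\<lambda>n. dist (y n) y0"] always_eventually) (auto simp: dist_commute)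
    then have "y \<longlonglongrightarrow> y0" using tendsto_dist_iff by blast
    then have "(\<lambda>n. (y n, x n)) \<longlonglongrightarrow> (y0, l)" using l by (rule tendsto_Pair)
    then have "(y0, l) \<in> {p. snd p \<in> F (fst p)}"
      using closed_sequentially[OF graph, of "\<lambda>n. (y n, x n)" "(y0, l)"] x by simp
    then show False using empty by simp
  qed
  then show ?thesis unfolding locally_upper_lipschitzian_at_def using c by (metis empty_subsetI)
qed

lemma locally_upper_lipschitzian_at_UN:
  assumes fin: "finite J" and lul: "\<And>j. j \<in> J \<Longrightarrow> locally_upper_lipschitzian_at (F j) y0 (k j)"
    and c: "0 < c" and le: "\<And>j. j \<in> J \<Longrightarrow> k j \<le> c"
  shows "locally_upper_lipschitzian_at (\<lambda>y. \<Union>j\<in>J. F j y) y0 c"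
proof -
  have "\<exists>\<epsilon>. \<forall>j\<in>J. 0 < \<epsilon> j \<and> (\<forall>y\<in>ball y0 (\<epsilon> j).
      F j y \<subseteq> F j y0 + (\<lambda>b. (k j * norm (y - y0)) *\<^sub>R b) ` cball 0 1)"
    using lul unfolding locally_upper_lipschitzian_at_def by (intro bchoice) blast
  then obtain \<epsilon> where \<epsilon>: "\<And>j. j \<in> J \<Longrightarrow> 0 < \<epsilon> j"
    and sub: "\<And>j y. j \<in> J \<Longrightarrow> y \<in> ball y0 (\<epsilon> j) \<Longrightarrow>
      F j y \<subseteq> F j y0 + (\<lambda>b. (k j * norm (y - y0)) *\<^sub>R b) ` cball 0 1" by blast
  define e where "e = Min (insert 1 (\<epsilon> ` J))"
  have e: "0 < e" using fin \<epsilon> by (simp add: e_def)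
  have "(\<Union>j\<in>J. F j y) \<subseteq> (\<Union>j\<in>J. F j y0) + (\<lambda>b. (c * norm (y - y0)) *\<^sub>R b) ` cball 0 1"
    if y: "y \<in> ball y0 e" for y
  proof
    fix x assume "x \<in> (\<Union>j\<in>J. F j y)"
    then obtain j where j: "j \<in> J" "x \<in> F j y" by blast
    have "e \<le> \<epsilon> j" using fin j(1) by (simp add: e_def)
    then have "y \<in> ball y0 (\<epsilon> j)" using y by simp
    then have "x \<in> F j y0 + (\<lambda>b. (k j * norm (y - y0)) *\<^sub>R b) ` cball 0 1" using sub j by blast
    then obtain z b where z: "z \<in> F j y0" and b: "norm b \<le> 1"
      and x: "x = z + (k j * norm (y - y0)) *\<^sub>R b" by (auto elim!: set_plus_elim)
    have "0 < k j" using lul[OF j(1)] by (simp add: locally_upper_lipschitzian_at_def)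
    then have "norm (x - z) \<le> k j * norm (y - y0) * 1"
      using b by (simp add: x abs_mult mult_left_le)
    also have "\<dots> \<le> c * norm (y - y0)" using le[OF j(1)] by (simp add: mult_right_mono)
    finally show "x \<in> (\<Union>j\<in>J. F j y0) + (\<lambda>b. (c * norm (y - y0)) *\<^sub>R b) ` cball 0 1"
      using z j(1) by (intro mem_plus_scaled_cball[of z]) auto
  qed
  then show ?thesis unfolding locally_upper_lipschitzian_at_def using c e by blast
qed

section \<open>The inverse residual mapping as a finite union of polyhedral pieces\<close>

lemma residual_eq_iff:
  fixes C :: "'a::{real_inner,banach} set"
  assumes "closed C" "convex C" "C \<noteq> {}"
  shows "residual M q C x = y \<longleftrightarrow>
    x - y \<in> C \<and> (\<forall>z\<in>C. (y - M x - q) \<bullet> (z - (x - y)) \<le> 0)"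
proof -
  have "residual M q C x = y \<longleftrightarrow> metric_projection C (x - M x - q) = x - y"
    unfolding residual_def by (auto simp: algebra_simps)
  also have "\<dots> \<longleftrightarrow> x - y \<in> C \<and> (\<forall>z\<in>C. (x - M x - q - (x - y)) \<bullet> (z - (x - y)) \<le> 0)"
    by (rule metric_projection_eq_iff[OF assms])
  also have "x - M x - q - (x - y) = y - M x - q" by simp
  finally show ?thesis .
qed

text \<open>
  The solutions of \<open>R x = y\<close> for which the constraints in \<open>J\<close> are active at the projection \<open>x - y\<close> and
  their normals alone generate the normal vector \<open>y - M x - q\<close>.
\<close>

definition residual_piece ::
    "('a::real_inner \<Rightarrow> 'a) \<Rightarrow> 'a \<Rightarrow> ('i \<Rightarrow> 'a) \<Rightarrow> ('i \<Rightarrow> real) \<Rightarrow> 'i set \<Rightarrow> 'i set \<Rightarrow> 'a \<Rightarrow> 'a set" where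
  "residual_piece M q a \<alpha> I J y = {x. (\<forall>i\<in>I. a i \<bullet> (x - y) \<le> \<alpha> i) \<and>
     (\<forall>j\<in>J. a j \<bullet> (x - y) = \<alpha> j) \<and> y - M x - q \<in> generated_cone a J}"

text \<open>
  Farkas' lemma and Caratheodory's theorem give one inclusion. Conversely, a nonnegative combination
  of normals that are active at \<open>x - y\<close> is a normal vector there, by direct computation.
\<close>

lemma residual_inverse_eq_UN_pieces:
  fixes a :: "'i \<Rightarrow> 'a::{real_inner,banach}"
  assumes fin: "finite I" and C: "C = {x. \<forall>i\<in>I. a i \<bullet> x \<le> \<alpha> i}" "C \<noteq> {}"
  shows "{x. residual M q C x = y} =
    (\<Union>J\<in>{J. J \<subseteq> I \<and> independent_family a J}. residual_piece M q a \<alpha> I J y)"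
proof -
  have "closed C" "convex C" by (simp_all add: C closed_polyhedron convex_polyhedron)
  note iff = residual_eq_iff[OF this C(2), of M q _ y]
  show ?thesis
  proof (intro equalityI subsetI)
    fix x assume "x \<in> {x. residual M q C x = y}"
    then have mem: "x - y \<in> C" and normal: "\<And>z. z \<in> C \<Longrightarrow> (y - M x - q) \<bullet> (z - (x - y)) \<le> 0"
      using iff by auto
    define A where "A = {i \<in> I. a i \<bullet> (x - y) = \<alpha> i}"
    have "y - M x - q \<in> generated_cone a A"
      unfolding A_def using mem normal by (intro normal_cone_polyhedron[OF fin]) (auto simp: C(1))
    moreover have "finite A" using fin by (simp add: A_def)
    ultimately obtain J where "J \<subseteq> A" "independent_family a J" "y - M x - q \<in> generated_cone a J"
      using conic_caratheodory[of A] by blast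
    moreover from this have "x \<in> residual_piece M q a \<alpha> I J y"
      using mem by (auto simp: residual_piece_def A_def C(1))
    ultimately show "x \<in> (\<Union>J\<in>{J. J \<subseteq> I \<and> independent_family a J}. residual_piece M q a \<alpha> I J y)"
      by (auto simp: A_def)
  next
    fix x assume "x \<in> (\<Union>J\<in>{J. J \<subseteq> I \<and> independent_family a J}. residual_piece M q a \<alpha> I J y)"
    then obtain J where J: "J \<subseteq> I" and mem: "\<forall>i\<in>I. a i \<bullet> (x - y) \<le> \<alpha> i"
      and active: "\<forall>j\<in>J. a j \<bullet> (x - y) = \<alpha> j" and cone: "y - M x - q \<in> generated_cone a J"
      by (auto simp: residual_piece_def)
    obtain l where l: "\<forall>j\<in>J. 0 \<le> l j" and eq: "y - M x - q = (\<Sum>j\<in>J. l j *\<^sub>R a j)"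
      using cone unfolding generated_cone_def by blast
    have "(y - M x - q) \<bullet> (z - (x - y)) \<le> 0" if "z \<in> C" for z
    proof -
      have "a j \<bullet> (z - (x - y)) \<le> 0" if "j \<in> J" for j
        using \<open>z \<in> C\<close> that J active by (auto simp: C(1) inner_diff_right)
      then have "(\<Sum>j\<in>J. l j * (a j \<bullet> (z - (x - y)))) \<le> 0"
        using l by (intro sum_nonpos) (simp add: mult_nonneg_nonpos)
      then show ?thesis unfolding eq by (simp add: inner_sum_left)
    qed
    then show "x \<in> {x. residual M q C x = y}" using iff mem by (auto simp: C(1))
  qed
qed

lemma closed_residual_piece_graph:
  fixes a :: "'i \<Rightarrow> 'a::{real_inner,banach}"
  assumes "bounded_linear M" "finite J"
  shows "closed {p. snd p \<in> residual_piece M q a \<alpha> I J (fst p)}"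
proof -
  interpret M: bounded_linear M by fact
  have "{p. snd p \<in> residual_piece M q a \<alpha> I J (fst p)} =
      (\<Inter>i\<in>I. {p. a i \<bullet> (snd p - fst p) \<le> \<alpha> i}) \<inter> (\<Inter>j\<in>J. {p. a j \<bullet> (snd p - fst p) = \<alpha> j}) \<inter>
      (\<lambda>p. fst p - M (snd p) - q) -` generated_cone a J"
    unfolding residual_piece_def by auto
  moreover have "closed ((\<lambda>p. fst p - M (snd p) - q) -` generated_cone a J)"
    by (intro continuous_closed_vimage closed_generated_cone assms(2))
      (auto intro!: continuous_intros M.continuous)
  moreover have "closed (\<Inter>i\<in>I. {p. a i \<bullet> (snd p - fst p) \<le> \<alpha> i})"
    by (intro closed_INT ballI closed_Collect_le continuous_intros)
  moreover have "closed (\<Inter>j\<in>J. {p. a j \<bullet> (snd p - fst p) = \<alpha> j})"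
    by (intro closed_INT ballI closed_Collect_eq continuous_intros)
  ultimately show ?thesis by (simp only: closed_Int)
qed

text \<open>
  If \<open>d\<close> is dual to \<open>a\<close> on \<open>J\<close>, this is the linear projection along the span of the \<open>a j\<close> onto the
  common kernel of the \<open>d j\<close>. It turns the statement that a vector is a combination of the \<open>a j\<close>
  into a linear equation.
\<close>

definition dual_remainder :: "('i \<Rightarrow> 'a::real_inner) \<Rightarrow> ('i \<Rightarrow> 'a) \<Rightarrow> 'i set \<Rightarrow> 'a \<Rightarrow> 'a" where
  "dual_remainder d a J v = v - (\<Sum>j\<in>J. (d j \<bullet> v) *\<^sub>R a j)"

lemma bounded_linear_dual_remainder: "bounded_linear (dual_remainder d a J)"
  unfolding dual_remainder_def
  by (intro bounded_linear_sub bounded_linear_ident bounded_linear_sum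
      bounded_linear_scaleR_const bounded_linear_inner_right)

lemma dual_remainder_eq_0_on_span:
  assumes "finite J" "dual_family d a J" "s \<in> span (a ` J)"
  shows "dual_remainder d a J s = 0"
proof -
  obtain u where s: "s = (\<Sum>j\<in>J. u j *\<^sub>R a j)" using span_image_imp_sum[OF assms(1,3)] .
  have "(\<Sum>j\<in>J. (d j \<bullet> s) *\<^sub>R a j) = (\<Sum>j\<in>J. u j *\<^sub>R a j)"
    unfolding s by (intro sum.cong refl) (simp add: dual_family_coefficient[OF assms(1,2)])
  then show ?thesis using s by (simp add: dual_remainder_def)
qed

text \<open>
  Since the remainder map \<open>Q\<close> vanishes on the span of the \<open>a j\<close> and fixes the vectors orthogonal to all
  \<open>d j\<close>, the range of \<open>Q \<circ> M\<close> consists of the vectors of \<open>range M + span (a ` J)\<close> orthogonal to all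
  \<open>d j\<close>.
\<close>

lemma closed_range_dual_remainder:
  fixes M :: "'b::real_vector \<Rightarrow> 'a::{real_inner,banach}"
  assumes "linear M" "closed (range M)" and fin: "finite J" and d: "dual_family d a J"
  shows "closed (range (\<lambda>x. dual_remainder d a J (M x)))"
proof -
  let ?Q = "dual_remainder d a J"
  interpret Q: bounded_linear ?Q by (rule bounded_linear_dual_remainder)
  define V where "V = {w + s | w s. w \<in> range M \<and> s \<in> span (a ` J)}"
  have "closed V" unfolding V_def
    using assms(1,2) fin
    by (intro closed_subspace_plus_finite_span linear_subspace_image subspace_UNIV) auto
  have "range (\<lambda>x. ?Q (M x)) = V \<inter> (\<Inter>j\<in>J. {v. d j \<bullet> v = 0})"
  proof (intro equalityI subsetI)
    fix v assume "v \<in> range (\<lambda>x. ?Q (M x))"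
    then obtain x where v: "v = ?Q (M x)" by blast
    have "v = M x + - (\<Sum>j\<in>J. (d j \<bullet> M x) *\<^sub>R a j)" by (simp add: v dual_remainder_def)
    moreover have "- (\<Sum>j\<in>J. (d j \<bullet> M x) *\<^sub>R a j) \<in> span (a ` J)"
      by (intro span_neg span_sum span_scale span_base) auto
    ultimately have "v \<in> V" unfolding V_def by blast
    moreover have "d j \<bullet> v = 0" if "j \<in> J" for j
      using dual_family_coefficient[OF fin d that, of "\<lambda>k. d k \<bullet> M x"]
      by (simp add: v dual_remainder_def inner_diff_right)
    ultimately show "v \<in> V \<inter> (\<Inter>j\<in>J. {v. d j \<bullet> v = 0})" by blast
  next
    fix v assume v: "v \<in> V \<inter> (\<Inter>j\<in>J. {v. d j \<bullet> v = 0})"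
    then obtain x s where eq: "v = M x + s" and s: "s \<in> span (a ` J)" unfolding V_def by blast
    have "v = ?Q v" using v by (simp add: dual_remainder_def)
    also have "\<dots> = ?Q (M x)" by (simp add: eq Q.add dual_remainder_eq_0_on_span[OF fin d s])
    finally show "v \<in> range (\<lambda>x. ?Q (M x))" by blast
  qed
  moreover have "closed (\<Inter>j\<in>J. {v. d j \<bullet> v = 0})"
    by (intro closed_INT ballI closed_Collect_eq continuous_intros)
  ultimately show ?thesis using \<open>closed V\<close> by (simp only: closed_Int)
qed

text \<open>
  A piece is the solution set of one operator equation and finitely many inequalities whose
  right-hand sides are Lipschitz in \<open>y\<close>. A solution for \<open>y\<close> therefore violates the system for \<open>y'\<close>
  by at most a multiple of \<open>norm (y - y')\<close>, and the error bound applies as soon as the system for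
  \<open>y'\<close> is solvable.
\<close>

lemma residual_piece_lipschitz_on_domain:
  fixes a :: "'i \<Rightarrow> 'a::{real_inner,banach}"
  assumes M: "bounded_linear M" and "closed (range M)" and fin: "finite I"
    and J: "J \<subseteq> I" "independent_family a J"
  shows "\<exists>c>0. \<forall>y x y'. x \<in> residual_piece M q a \<alpha> I J y \<longrightarrow> residual_piece M q a \<alpha> I J y' \<noteq> {} \<longrightarrow>
    (\<exists>x'\<in>residual_piece M q a \<alpha> I J y'. norm (x - x') \<le> c * norm (y - y'))"
proof -
  interpret M: bounded_linear M by fact
  have finJ: "finite J" using J(1) fin by (rule finite_subset)
  obtain d where d: "dual_family d a J"
    using dual_family_exists[OF finJ J(2)] by blast
  let ?Q = "dual_remainder d a J"
  interpret Q: bounded_linear ?Q by (rule bounded_linear_dual_remainder)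
  define T where "T x = ?Q (M x)" for x
  have T: "bounded_linear T" "closed (range T)"
    unfolding T_def using bounded_linear_compose[OF Q.bounded_linear_axioms M]
      closed_range_dual_remainder[OF M.linear assms(2) finJ d] by auto
  \<comment> \<open>The three kinds of inequalities: all constraints of the polyhedron, the reversed
    inequalities that make those in \<open>J\<close> active, and the signs of the coefficients of the normal vector.\<close>
  define f where "f = case_sum (\<lambda>i x. a i \<bullet> x) (case_sum (\<lambda>j x. - (a j \<bullet> x)) (\<lambda>j x. d j \<bullet> M x))"
  define \<beta> where "\<beta> y = case_sum (\<lambda>i. \<alpha> i + a i \<bullet> y)
    (case_sum (\<lambda>j. - (\<alpha> j + a j \<bullet> y)) (\<lambda>j. d j \<bullet> (y - q)))" for y
  let ?K = "I <+> (J <+> J)"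
  have ball_K: "(\<forall>k\<in>?K. P k) \<longleftrightarrow>
      (\<forall>i\<in>I. P (Inl i)) \<and> (\<forall>j\<in>J. P (Inr (Inl j))) \<and> (\<forall>j\<in>J. P (Inr (Inr j)))" for P
    by auto
  have f: "\<forall>k\<in>?K. bounded_linear (f k)"
    unfolding f_def
    by (auto intro!: bounded_linear_minus bounded_linear_inner_right_comp M
        bounded_linear_inner_right)
  have piece: "residual_piece M q a \<alpha> I J y = {x. T x = ?Q (y - q) \<and> (\<forall>k\<in>?K. f k x \<le> \<beta> y k)}" for y
  proof -
    have "y - M x - q \<in> generated_cone a J \<longleftrightarrow>
        T x = ?Q (y - q) \<and> (\<forall>j\<in>J. d j \<bullet> M x \<le> d j \<bullet> (y - q))" for x
    proof -
      have "y - M x - q \<in> generated_cone a J \<longleftrightarrow>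
          (\<forall>j\<in>J. 0 \<le> d j \<bullet> (y - M x - q)) \<and> ?Q (y - M x - q) = 0"
        unfolding generated_cone_iff_dual[OF finJ d] by (simp add: dual_remainder_def)
      moreover have "?Q (y - M x - q) = ?Q (y - q) - T x" by (simp add: T_def Q.diff)
      ultimately show ?thesis by (auto simp: inner_diff_right algebra_simps)
    qed
    moreover have "(\<forall>j\<in>J. a j \<bullet> (x - y) = \<alpha> j) \<longleftrightarrow> (\<forall>j\<in>J. \<alpha> j \<le> a j \<bullet> (x - y))"
      if "\<forall>i\<in>I. a i \<bullet> (x - y) \<le> \<alpha> i" for x
      using that J(1) by (auto intro: order.antisym)
    ultimately show ?thesis
      unfolding residual_piece_def ball_K f_def \<beta>_def
      by (auto simp: inner_diff_right algebra_simps)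
  qed
  obtain c where c: "0 < c" and hoffman: "\<forall>\<beta> \<delta> x x0. (\<forall>k\<in>?K. f k x0 \<le> \<beta> k) \<longrightarrow> 0 \<le> \<delta> \<longrightarrow>
      norm (T x - T x0) \<le> \<delta> \<longrightarrow> (\<forall>k\<in>?K. f k x \<le> \<beta> k + \<delta>) \<longrightarrow>
      (\<exists>p. T p = T x0 \<and> (\<forall>k\<in>?K. f k p \<le> \<beta> k) \<and> norm (x - p) \<le> c * \<delta>)"
    using hoffman_error_bound_closed_range[OF T finite_Plus[OF fin finite_Plus[OF finJ finJ]] f]
    by (elim exE conjE) (rule that)
  obtain B where B: "0 < B" "\<And>v. norm (?Q v) \<le> B * norm v"
    using Q.pos_bounded by (metis mult.commute)
  define L where "L = B + (\<Sum>i\<in>I. norm (a i)) + (\<Sum>j\<in>J. norm (d j))"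
  have sums: "0 \<le> (\<Sum>i\<in>I. norm (a i))" "0 \<le> (\<Sum>j\<in>J. norm (d j))" by (auto intro: sum_nonneg)
  then have L: "0 < L" using B(1) by (simp add: L_def)
  have a_le: "\<bar>a i \<bullet> v\<bar> \<le> L * norm v" if "i \<in> I" for i v
  proof -
    have "norm (a i) \<le> (\<Sum>i\<in>I. norm (a i))" using fin that by (intro member_le_sum) auto
    then have "norm (a i) \<le> L" using sums B(1) by (simp add: L_def)
    then show ?thesis
      using Cauchy_Schwarz_ineq2[of "a i" v] mult_right_mono[of "norm (a i)" L "norm v"] by simp
  qed
  have d_le: "\<bar>d j \<bullet> v\<bar> \<le> L * norm v" if "j \<in> J" for j v
  proof -
    have "norm (d j) \<le> (\<Sum>j\<in>J. norm (d j))" using finJ that by (intro member_le_sum) auto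
    then have "norm (d j) \<le> L" using sums B(1) by (simp add: L_def)
    then show ?thesis
      using Cauchy_Schwarz_ineq2[of "d j" v] mult_right_mono[of "norm (d j)" L "norm v"] by simp
  qed
  have Q_le: "norm (?Q v) \<le> L * norm v" for v
    using B(2)[of v] mult_right_mono[of B L "norm v"] sums by (simp add: L_def)
  have "\<exists>x'\<in>residual_piece M q a \<alpha> I J y'. norm (x - x') \<le> (c * L) * norm (y - y')"
    if x: "x \<in> residual_piece M q a \<alpha> I J y" and ne: "residual_piece M q a \<alpha> I J y' \<noteq> {}" for x y y'
  proof -
    obtain x0 where x0: "x0 \<in> residual_piece M q a \<alpha> I J y'" using ne by blast
    define \<delta> where "\<delta> = L * norm (y - y')"
    have 1: "\<forall>k\<in>?K. f k x0 \<le> \<beta> y' k" and T0: "T x0 = ?Q (y' - q)" using x0 by (simp_all add: piece)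
    have 2: "0 \<le> \<delta>" using L by (simp add: \<delta>_def)
    have "T x - T x0 = ?Q (y - y')" using x T0 by (simp add: piece Q.diff)
    then have 3: "norm (T x - T x0) \<le> \<delta>" using Q_le by (simp add: \<delta>_def)
    have "\<beta> y k \<le> \<beta> y' k + \<delta>" if "k \<in> ?K" for k
    proof -
      have "a i \<bullet> y \<le> a i \<bullet> y' + \<delta>" "- (a i \<bullet> y) \<le> \<delta> - a i \<bullet> y'" if "i \<in> I" for i
        using a_le[OF that, of "y - y'"] by (simp_all add: \<delta>_def inner_diff_right)
      moreover have "d j \<bullet> y \<le> d j \<bullet> y' + \<delta>" if "j \<in> J" for j
        using d_le[OF that, of "y - y'"] by (simp add: \<delta>_def inner_diff_right)
      ultimately show ?thesis using that J(1) by (auto simp: \<beta>_def inner_diff_right)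
    qed
    then have 4: "\<forall>k\<in>?K. f k x \<le> \<beta> y' k + \<delta>" using x by (force simp: piece)
    obtain p where "T p = T x0" "\<forall>k\<in>?K. f k p \<le> \<beta> y' k" "norm (x - p) \<le> c * \<delta>"
      using hoffman[rule_format, OF _ 2 3] 1 4 by blast
    then show ?thesis using T0 by (intro bexI[of _ p]) (simp_all add: piece \<delta>_def mult.assoc)
  qed
  then show ?thesis using c L by (intro exI[of _ "c * L"]) simp
qed

theorem theorem2p1:
  fixes M :: "'a::{real_inner,banach} \<Rightarrow> 'a"
    and q :: 'a
    and C :: "'a set"
    and m :: nat
    and xs :: "nat \<Rightarrow> 'a"
    and \<alpha> :: "nat \<Rightarrow> real"
  assumes "bounded_linear M"
    and "closed (range M)"
    and "C = {x. \<forall>i\<in>{1..m}. xs i \<bullet> x \<le> \<alpha> i}"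
    and "C \<noteq> {}"
  shows "\<exists>c>0. \<forall>y0. locally_upper_lipschitzian_at (\<lambda>y. {x. residual M q C x = y}) y0 c"
proof -
  define \<J> where "\<J> = {J. J \<subseteq> {1..m} \<and> independent_family xs J}"
  have fin: "finite \<J>" by (simp add: \<J>_def)
  define F where "F = residual_piece M q xs \<alpha> {1..m}"
  have "\<exists>k. \<forall>J\<in>\<J>. 0 < k J \<and> (\<forall>y x y'. x \<in> F J y \<longrightarrow> F J y' \<noteq> {} \<longrightarrow>
      (\<exists>x'\<in>F J y'. norm (x - x') \<le> k J * norm (y - y')))"
    unfolding F_def
    by (intro bchoice ballI residual_piece_lipschitz_on_domain assms(1,2)) (auto simp: \<J>_def)
  then obtain k where k: "\<And>J. J \<in> \<J> \<Longrightarrow> 0 < k J"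
    and lip: "\<And>J y x y'. J \<in> \<J> \<Longrightarrow> x \<in> F J y \<Longrightarrow> F J y' \<noteq> {} \<Longrightarrow>
      \<exists>x'\<in>F J y'. norm (x - x') \<le> k J * norm (y - y')" by blast
  define c where "c = 1 + sum k \<J>"
  have "0 \<le> sum k \<J>" using k by (intro sum_nonneg less_imp_le)
  then have c: "0 < c" by (simp add: c_def)
  have "locally_upper_lipschitzian_at (\<lambda>y. {x. residual M q C x = y}) y0 c" for y0
  proof -
    have "locally_upper_lipschitzian_at (\<lambda>y. \<Union>J\<in>\<J>. F J y) y0 c"
    proof (rule locally_upper_lipschitzian_at_UN[OF fin _ c])
      fix J assume J: "J \<in> \<J>"
      have "finite J" using J by (auto simp: \<J>_def intro: finite_subset)
      then show "locally_upper_lipschitzian_at (F J) y0 (k J)"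
        using lip[OF J] closed_residual_piece_graph[OF assms(1)]
        by (intro locally_upper_lipschitzian_if_lipschitz_on_domain k J) (auto simp: F_def)
      have "k J \<le> sum k \<J>" using fin J k by (intro member_le_sum) (auto intro: less_imp_le)
      then show "k J \<le> c" by (simp add: c_def)
    qed
    then show ?thesis
      using residual_inverse_eq_UN_pieces[OF _ assms(3,4), of M q] by (simp add: F_def \<J>_def)
  qed
  with c show ?thesis by blast
qed

end
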